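(* There is a three-parameter reduction of ${}_3F_2$ to a single ${}_2F_1$; namely, for $|x|<1$, $${}_3F_2(a_1,a_2,e+1;\,b_1,e;\,x)=(1-x)\,{}_2F_1(a_1+1,a_2+1;\,b_1;\,x),$$ in which $e:=e(a_1,a_2;b_1)=a_1a_2/(a_1+a_2-b_1+1)$.
   Context: ${}_3F_2(a_1,a_2,a_3;b_1,b_2;x)=\sum_{n\ge0}\frac{(a_1)_n(a_2)_n(a_3)_n}{(b_1)_n(b_2)_n\,n!}x^n$ and ${}_2F_1(\alpha,\beta;\gamma;x)=\sum_{n\ge0}\frac{(\alpha)_n(\beta)_n}{(\gamma)_n\,n!}x^n$ for $|x|<1$. The parameters $a_1,a_2,b_1$ are complex numbers such that $e$ is finite (i.e. $a_1+a_2-b_1+1\neq0$), and the lower parameters $b_1,e$ are not nonpositive integers. *)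

theory Defs
  imports "HOL-Analysis.Analysis"
begin

text \<open>
  The library has generalised hypergeometric series only as formal power series
  (\<^const>\<open>fps_hypergeo\<close>, whose last argument scales the variable); the functions below are the
  sums of these series. Where the series diverges their value is unspecified.
\<close>

definition hypergeo_3F2 ::
  "complex \<Rightarrow> complex \<Rightarrow> complex \<Rightarrow> complex \<Rightarrow> complex \<Rightarrow> complex \<Rightarrow> complex" where
  "hypergeo_3F2 a1 a2 a3 b1 b2 x = eval_fps (fps_hypergeo [a1, a2, a3] [b1, b2] 1) x"

definition hypergeo_2F1 :: "complex \<Rightarrow> complex \<Rightarrow> complex \<Rightarrow> complex \<Rightarrow> complex" where
  "hypergeo_2F1 \<alpha> \<beta> \<gamma> x = eval_fps (fps_hypergeo [\<alpha>, \<beta>] [\<gamma>] 1) x"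

definition reduction_param :: "complex \<Rightarrow> complex \<Rightarrow> complex \<Rightarrow> complex" where
  "reduction_param a1 a2 b1 = a1 * a2 / (a1 + a2 - b1 + 1)"

lemma hypergeo_3F2_eq_suminf:
  "hypergeo_3F2 a1 a2 a3 b1 b2 x =
     (\<Sum>n. pochhammer a1 n * pochhammer a2 n * pochhammer a3 n /
           (pochhammer b1 n * pochhammer b2 n * fact n) * x ^ n)"
  by (simp add: hypergeo_3F2_def eval_fps_def)

lemma hypergeo_2F1_eq_suminf:
  "hypergeo_2F1 \<alpha> \<beta> \<gamma> x =
     (\<Sum>n. pochhammer \<alpha> n * pochhammer \<beta> n / (pochhammer \<gamma> n * fact n) * x ^ n)"
  by (simp add: hypergeo_2F1_def eval_fps_def)

lemma summable_power_series_ratio_1: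
  fixes f R :: "nat \<Rightarrow> complex"
  assumes step: "\<And>n. f (Suc n) = f n * R n" and R: "R \<longlonglongrightarrow> 1" and x: "norm x < 1"
  shows "summable (\<lambda>n. f n * x ^ n)"
proof -
  obtain c where c: "norm x < c" "c < 1"
    using dense x by blast
  have "(\<lambda>n. norm (R n * x)) \<longlonglongrightarrow> norm (1 * x)"
    by (intro tendsto_intros R)
  then have "eventually (\<lambda>n. norm (R n * x) < c) sequentially"
    using c(1) by (auto intro: order_tendstoD)
  then obtain N where N: "\<And>n. n \<ge> N \<Longrightarrow> norm (R n * x) < c"
    by (auto simp: eventually_sequentially)
  show ?thesis
  proof (rule summable_ratio_test[OF c(2)])
    fix n assume "n \<ge> N"
    have "f (Suc n) * x ^ Suc n = (R n * x) * (f n * x ^ n)"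
      by (simp add: step)
    then have "norm (f (Suc n) * x ^ Suc n) = norm (R n * x) * norm (f n * x ^ n)"
      by (simp only: norm_mult)
    also have "\<dots> \<le> c * norm (f n * x ^ n)"
      using N[OF \<open>n \<ge> N\<close>] by (intro mult_right_mono) auto
    finally show "norm (f (Suc n) * x ^ Suc n) \<le> c * norm (f n * x ^ n)" .
  qed
qed

lemma tendsto_shift_ratio:
  "(\<lambda>n. (a + of_nat n) / (b + of_nat n)) \<longlonglongrightarrow> (1 :: complex)"
proof -
  have *: "(\<lambda>n. (a / of_nat n + 1) / (b / of_nat n + 1)) \<longlonglongrightarrow> (0 + 1) / (0 + 1 :: complex)"
    by (intro tendsto_intros tendsto_divide_0[OF tendsto_const] tendsto_of_nat) auto
  have "eventually (\<lambda>n. (a / of_nat n + 1) / (b / of_nat n + 1) =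
          (a + of_nat n) / (b + of_nat n)) sequentially"
    using eventually_gt_at_top[of 0]
  proof eventually_elim
    case (elim n)
    then have "a / of_nat n + 1 = (a + of_nat n) / of_nat n"
      and "b / of_nat n + 1 = (b + of_nat n) / of_nat n"
      by (simp_all add: field_simps)
    then show ?case using elim by simp
  qed
  from tendsto_cong[THEN iffD1, OF this *] show ?thesis by simp
qed

lemma summable_hypergeo_3F2:
  assumes "norm (x :: complex) < 1"
  shows "summable (\<lambda>n. pochhammer a1 n * pochhammer a2 n * pochhammer a3 n /
           (pochhammer b1 n * pochhammer b2 n * fact n) * x ^ n)"
proof (rule summable_power_series_ratio_1[OF _ _ assms])
  let ?R = "\<lambda>n. (a1 + of_nat n) / (b1 + of_nat n) * ((a2 + of_nat n) / (b2 + of_nat n)) *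
              ((a3 + of_nat n) / (1 + of_nat n))"
  have "?R \<longlonglongrightarrow> 1 * 1 * 1"
    by (intro tendsto_mult tendsto_shift_ratio)
  then show "?R \<longlonglongrightarrow> 1" by simp
qed (simp add: pochhammer_Suc mult_ac)

lemma summable_hypergeo_2F1:
  assumes "norm (x :: complex) < 1"
  shows "summable (\<lambda>n. pochhammer \<alpha> n * pochhammer \<beta> n / (pochhammer \<gamma> n * fact n) * x ^ n)"
proof (rule summable_power_series_ratio_1[OF _ _ assms])
  let ?R = "\<lambda>n. (\<alpha> + of_nat n) / (\<gamma> + of_nat n) * ((\<beta> + of_nat n) / (1 + of_nat n))"
  have "?R \<longlonglongrightarrow> 1 * 1"
    by (intro tendsto_mult tendsto_shift_ratio)
  then show "?R \<longlonglongrightarrow> 1" by simp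
qed (simp add: pochhammer_Suc mult_ac)

end

theory Submission
  imports Defs
begin

text \<open>
  Multiplying a power series by \<open>1 - x\<close> replaces its coefficients \<open>c\<^sub>n\<close> by the differences
  \<open>c\<^sub>n - c\<^sub>n\<^sub>-\<^sub>1\<close>, so the theorem is a statement about the coefficients
  \<open>c\<^sub>n = (a\<^sub>1 + 1)\<^sub>n (a\<^sub>2 + 1)\<^sub>n / ((b\<^sub>1)\<^sub>n n!)\<close> of the \<open>2F1\<close>. By the recurrence of the
  Pochhammer symbols,

  \<open>c\<^sub>m\<^sub>+\<^sub>1 - c\<^sub>m = c\<^sub>m [(a\<^sub>1 + 1 + m) (a\<^sub>2 + 1 + m) - (b\<^sub>1 + m) (m + 1)] / ((b\<^sub>1 + m) (m + 1))\<close>.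

  The quadratic terms in \<open>m\<close> cancel: the bracket in the numerator is
  \<open>a\<^sub>1 a\<^sub>2 + (m + 1) s\<close> with \<open>s = a\<^sub>1 + a\<^sub>2 - b\<^sub>1 + 1\<close>, that is, \<open>s (e + m + 1)\<close>. The parameter \<open>e\<close>
  is thus minus the root of this linear polynomial in \<open>m + 1\<close>. A pair of parameters \<open>e + 1\<close> above and \<open>e\<close>
  below contributes exactly a linear factor to a hypergeometric coefficient, because
  \<open>(e + 1)\<^sub>n / (e)\<^sub>n = (e + n) / e\<close>; this is the factor just found, and the constant \<open>s e = a\<^sub>1 a\<^sub>2\<close>
  turns \<open>(a\<^sub>i + 1)\<^sub>m\<close> into \<open>(a\<^sub>i)\<^sub>m\<^sub>+\<^sub>1\<close>.
\<close>

lemma sums_mult_one_minus: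
  fixes c d :: "nat \<Rightarrow> 'a :: {real_normed_algebra_1, comm_ring_1}"
  assumes c: "(\<lambda>n. c n * x ^ n) sums S"
    and d_0: "d 0 = c 0"
    and d_Suc: "\<And>n. d (Suc n) = c (Suc n) - c n"
  shows "(\<lambda>n. d n * x ^ n) sums ((1 - x) * S)"
proof -
  have "(\<lambda>n. c (Suc n) * x ^ Suc n) sums (S - c 0)"
    using c by (subst sums_Suc_iff) simp
  moreover have "(\<lambda>n. x * (c n * x ^ n)) sums (x * S)"
    using c by (rule sums_mult)
  ultimately have "(\<lambda>n. c (Suc n) * x ^ Suc n - x * (c n * x ^ n)) sums (S - c 0 - x * S)"
    by (rule sums_diff)
  then have "(\<lambda>n. d (Suc n) * x ^ Suc n) sums (S - c 0 - x * S)"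
    by (simp add: d_Suc algebra_simps)
  from sums_Suc[OF this] show ?thesis
    by (simp add: d_0 algebra_simps)
qed

text \<open>
  The two sides evaluate \<open>(e)\<^sub>n\<^sub>+\<^sub>1\<close> by splitting off its first and its last factor. When \<open>e\<close>
  is not a nonpositive integer, one may divide by \<open>e (e)\<^sub>n\<close> to obtain
  \<open>(e + 1)\<^sub>n / (e)\<^sub>n = (e + n) / e\<close>.
\<close>

lemma mult_pochhammer_plus_1:
  fixes e :: "'a :: comm_semiring_1"
  shows "e * pochhammer (e + 1) n = pochhammer e n * (e + of_nat n)"
  using pochhammer_rec[of e n] pochhammer_Suc[of e n] by simp

text \<open>
  The hypothesis on \<open>e\<close> is the reduction parameter's equation \<open>s e = a\<^sub>1 a\<^sub>2\<close> with the division
  cleared. In this form it rewrites the numerator \<open>a\<^sub>1 a\<^sub>2 + (m + 1) s\<close> of the difference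
  as \<open>s (e + m + 1)\<close>, and, divided by \<open>e\<close>, it gives \<open>s = a\<^sub>1 a\<^sub>2 / e\<close>, which
  supplies the leading factors of \<open>(a\<^sub>1)\<^sub>m\<^sub>+\<^sub>1\<close> and \<open>(a\<^sub>2)\<^sub>m\<^sub>+\<^sub>1\<close>.
\<close>

lemma hypergeo_coeff_difference:
  fixes a1 a2 b1 e :: "'a :: field_char_0"
  assumes e: "(a1 + a2 - b1 + 1) * e = a1 * a2"
    and b1: "b1 \<notin> \<int>\<^sub>\<le>\<^sub>0" and e_nonpos: "e \<notin> \<int>\<^sub>\<le>\<^sub>0"
  defines "c \<equiv> \<lambda>n. pochhammer (a1 + 1) n * pochhammer (a2 + 1) n / (pochhammer b1 n * fact n)"
  shows "pochhammer a1 (Suc m) * pochhammer a2 (Suc m) * pochhammer (e + 1) (Suc m) /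
           (pochhammer b1 (Suc m) * pochhammer e (Suc m) * fact (Suc m)) = c (Suc m) - c m"
proof -
  let ?s = "a1 + a2 - b1 + 1" and ?k = "of_nat m :: 'a"
  have nz: "pochhammer b1 (Suc m) \<noteq> 0" "pochhammer e (Suc m) \<noteq> 0" "e \<noteq> 0"
    using b1 e_nonpos by (auto simp: pochhammer_eq_0_iff)
  have b1m: "b1 + ?k \<noteq> 0" "pochhammer b1 m \<noteq> 0"
    using nz(1) by (auto simp: pochhammer_Suc)
  have m1: "1 + ?k \<noteq> 0"
    using of_nat_neq_0[of m] by simp
  have quot: "pochhammer (e + 1) (Suc m) / pochhammer e (Suc m) = (e + 1 + ?k) / e"
    using mult_pochhammer_plus_1[of e "Suc m"] nz by (simp add: field_simps)
  have "c (Suc m) = c m * ((a1 + 1 + ?k) * (a2 + 1 + ?k) / ((b1 + ?k) * (1 + ?k)))"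
    by (simp add: c_def pochhammer_Suc mult_ac)
  then have "c (Suc m) - c m =
      c m * (((a1 + 1 + ?k) * (a2 + 1 + ?k) - (b1 + ?k) * (1 + ?k)) / ((b1 + ?k) * (1 + ?k)))"
    using b1m m1 by (simp add: diff_divide_distrib right_diff_distrib)
  also have "(a1 + 1 + ?k) * (a2 + 1 + ?k) - (b1 + ?k) * (1 + ?k) = a1 * a2 + (1 + ?k) * ?s"
    by (simp add: algebra_simps)
  also have "\<dots> = ?s * (e + 1 + ?k)"
    unfolding e[symmetric] by (simp add: algebra_simps)
  also have "?s = a1 * a2 / e"
    using e nz(3) by (simp add: field_simps)
  finally have diff: "c (Suc m) - c m =
      c m * (a1 * a2 / e * (e + 1 + ?k) / ((b1 + ?k) * (1 + ?k)))" .
  have "pochhammer a1 (Suc m) * pochhammer a2 (Suc m) * pochhammer (e + 1) (Suc m) /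
          (pochhammer b1 (Suc m) * pochhammer e (Suc m) * fact (Suc m)) =
        pochhammer a1 (Suc m) * pochhammer a2 (Suc m) / (pochhammer b1 (Suc m) * fact (Suc m)) *
          (pochhammer (e + 1) (Suc m) / pochhammer e (Suc m))"
    by simp
  also have "\<dots> = c m * (a1 * a2 / e * (e + 1 + ?k) / ((b1 + ?k) * (1 + ?k)))"
    unfolding quot c_def
      pochhammer_rec[of a1] pochhammer_rec[of a2] pochhammer_Suc[of b1]
    by (simp add: mult_ac)
  finally show ?thesis
    by (simp only: diff)
qed

theorem corollary6p1p2:
  fixes a1 a2 b1 e x :: complex
  assumes "a1 + a2 - b1 + 1 \<noteq> 0"
    and "e = reduction_param a1 a2 b1"
    and "b1 \<notin> \<int>\<^sub>\<le>\<^sub>0" and "e \<notin> \<int>\<^sub>\<le>\<^sub>0"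
    and "norm x < 1"
  shows "hypergeo_3F2 a1 a2 (e + 1) b1 e x =
           (1 - x) * hypergeo_2F1 (a1 + 1) (a2 + 1) b1 x"
proof -
  have e: "(a1 + a2 - b1 + 1) * e = a1 * a2"
    using assms(1,2) by (simp add: reduction_param_def)
  have "(\<lambda>n. pochhammer a1 n * pochhammer a2 n * pochhammer (e + 1) n /
           (pochhammer b1 n * pochhammer e n * fact n) * x ^ n)
        sums ((1 - x) * hypergeo_2F1 (a1 + 1) (a2 + 1) b1 x)"
  proof (rule sums_mult_one_minus)
    show "(\<lambda>n. pochhammer (a1 + 1) n * pochhammer (a2 + 1) n / (pochhammer b1 n * fact n) * x ^ n)
            sums hypergeo_2F1 (a1 + 1) (a2 + 1) b1 x"
      unfolding hypergeo_2F1_eq_suminf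
      by (intro summable_sums summable_hypergeo_2F1 assms(5))
  next
    fix n
    show "pochhammer a1 (Suc n) * pochhammer a2 (Suc n) * pochhammer (e + 1) (Suc n) /
            (pochhammer b1 (Suc n) * pochhammer e (Suc n) * fact (Suc n)) =
          pochhammer (a1 + 1) (Suc n) * pochhammer (a2 + 1) (Suc n) /
            (pochhammer b1 (Suc n) * fact (Suc n)) -
          pochhammer (a1 + 1) n * pochhammer (a2 + 1) n / (pochhammer b1 n * fact n)"
      using e assms(3,4) by (rule hypergeo_coeff_difference)
  qed simp
  then show ?thesis
    unfolding hypergeo_3F2_eq_suminf by (rule sums_unique[symmetric])
qed

end
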